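(* Let $(X,\|\cdot\|,\Omega)$ be a semi-dispersing Minkowski billiard and let $\gamma\colon I\to\overline{\Omega}$ be a billiard trajectory of finite length (that is, $I\subset\mathbb{R}$ is a bounded interval). Then the set of reflection moments of $\gamma$ is finite.
   Context: "Smooth" means $C^1$ throughout. Minkowski norm. A Minkowski space is a finite-dimensional real vector space $X$ with a Minkowski norm, i.e. a continuous function $\|\cdot\|\colon X\to\mathbb{R}$ such that: (i) $\|x\|>0$ for all $x\ne 0$; (ii) $\|tx\|=t\|x\|$ for all $x\in X$, $t\ge 0$; (iii) $\|x+y\|\le\|x\|+\|y\|$; (iv) strict convexity: the unit sphere $\{x:\|x\|=1\}$ contains no (nondegenerate) line segment; (v) $\|\cdot\|$ is $C^1$ on $X\setminus\{0\}$. The norm is not assumed symmetric: in general $\|x\|\ne\|-x\|$. Minkowski billiard. It is given by a Minkowski space $(X,\|\cdot\|)$ and a domain $\Omega\subset X$ (the billiard table), with closure $\overline{\Omega}$ and boundary $\partial\Omega$. A point $p\in\partial\Omega$ is smooth if in a neighborhood of $p$ the set $\partial\Omega$ is a smooth ($C^1$) hypersurface. Trajectory. A billiard trajectory is a continuous curve $\gamma\colon I\to\overline{\Omega}$, with $I\subset\mathbb{R}$ an interval, such that for every interior point $t\in I$ there is $\delta>0$ such that for all $t_1\in(t-\delta,t)$ and $t_2\in(t,t+\delta)$ at least one of the following holds: (1) $\gamma|_{[t_1,t_2]}$ parametrizes a segment of an affine line in $X$ with unit speed ($\|\dot\gamma\|=1$); (2) $p=\gamma(t)$ is a smooth point of $\partial\Omega$,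 the restrictions $\gamma|_{[t_1,t]}$ and $\gamma|_{[t,t_2]}$ are unit-speed parametrizations of the segments $[q_1,p]$ and $[p,q_2]$, where $q_1=\gamma(t_1)$, $q_2=\gamma(t_2)$, and $p$ is a critical point of the function $x\mapsto\|x-q_1\|+\|q_2-x\|$, $x\in\partial\Omega$. No condition is imposed at endpoints of $I$. The interior moments $t$ for which only condition (2) holds (so $\gamma$ has a genuine break at $t$) are the reflection moments, and the corresponding points $\gamma(t)$ are the reflection points. The length of $\gamma$ is the length of the interval $I$. Semi-dispersing. The billiard is semi-dispersing if $\Omega=X\setminus\bigcup_{i=1}^m W_i$, where $W_1,\dots,W_m\subset X$ (the walls) are closed convex sets with nonempty interiors and smooth boundaries. *)

theory Defs
  imports "HOL-Analysis.Analysis"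
begin

definition C1_with_derivative ::
  "('a::euclidean_space \<Rightarrow> real) \<Rightarrow> ('a \<Rightarrow> 'a \<Rightarrow>\<^sub>L real) \<Rightarrow> 'a set \<Rightarrow> bool" where
  "C1_with_derivative f f' S \<longleftrightarrow>
     (\<forall>x\<in>S. (f has_derivative blinfun_apply (f' x)) (at x)) \<and> continuous_on S f'"

text \<open>The type only supplies the vector space and its (unique) vector space topology; its Euclidean
  norm plays no role. Symmetry of \<open>N\<close> is not required.\<close>

definition minkowski_norm :: "('a::euclidean_space \<Rightarrow> real) \<Rightarrow> bool" where
  "minkowski_norm N \<longleftrightarrow>
     continuous_on UNIV N \<and>
     (\<forall>x. x \<noteq> 0 \<longrightarrow> N x > 0) \<and>
     (\<forall>x t. t \<ge> 0 \<longrightarrow> N (t *\<^sub>R x) = t * N x) \<and>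
     (\<forall>x y. N (x + y) \<le> N x + N y) \<and>
     (\<forall>x y. x \<noteq> y \<longrightarrow> \<not> closed_segment x y \<subseteq> {z. N z = 1}) \<and>
     (\<exists>N'. C1_with_derivative N N' (- {0}))"

text \<open>Within the open set \<open>U\<close>, the set \<open>S\<close> is the regular zero set of the \<open>C\<^sup>1\<close> function \<open>g\<close>.\<close>

definition C1_defining_function ::
  "'a::euclidean_space set \<Rightarrow> 'a set \<Rightarrow> ('a \<Rightarrow> real) \<Rightarrow> ('a \<Rightarrow> 'a \<Rightarrow>\<^sub>L real) \<Rightarrow> bool" where
  "C1_defining_function S U g g' \<longleftrightarrow>
     open U \<and> C1_with_derivative g g' U \<and> (\<forall>x\<in>U. g' x \<noteq> 0) \<and> S \<inter> U = {x\<in>U. g x = 0}"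

definition smooth_point :: "'a::euclidean_space set \<Rightarrow> 'a \<Rightarrow> bool" where
  "smooth_point S p \<longleftrightarrow> p \<in> S \<and> (\<exists>U g g'. p \<in> U \<and> C1_defining_function S U g g')"

text \<open>Meaningful at smooth points \<open>p\<close> of \<open>S\<close>, where the kernel of \<open>g' p\<close> is the same for all
  local defining functions \<open>g\<close>.\<close>

definition tangent_space :: "'a::euclidean_space set \<Rightarrow> 'a \<Rightarrow> 'a set" where
  "tangent_space S p =
     {v. \<exists>U g g'. p \<in> U \<and> C1_defining_function S U g g' \<and> blinfun_apply (g' p) v = 0}"

text \<open>Critical point of the restriction to \<open>S\<close> of a function \<open>F\<close> that is differentiable at \<open>p\<close>
  in the ambient space.\<close>

definition critical_point_on :: "('a::euclidean_space \<Rightarrow> real) \<Rightarrow> 'a set \<Rightarrow> 'a \<Rightarrow> bool" where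
  "critical_point_on F S p \<longleftrightarrow>
     smooth_point S p \<and>
     (\<exists>F'. (F has_derivative F') (at p) \<and> (\<forall>v\<in>tangent_space S p. F' v = 0))"

definition unit_speed_segment ::
  "('a::euclidean_space \<Rightarrow> real) \<Rightarrow> (real \<Rightarrow> 'a) \<Rightarrow> real \<Rightarrow> real \<Rightarrow> bool" where
  "unit_speed_segment N \<gamma> a b \<longleftrightarrow>
     (\<exists>v. N v = 1 \<and> (\<forall>s\<in>{a..b}. \<gamma> s = \<gamma> a + (s - a) *\<^sub>R v))"

definition reflects_at ::
  "('a::euclidean_space \<Rightarrow> real) \<Rightarrow> 'a set \<Rightarrow> (real \<Rightarrow> 'a) \<Rightarrow> real \<Rightarrow> real \<Rightarrow> real \<Rightarrow> bool" where
  "reflects_at N \<Omega> \<gamma> t\<^sub>1 t t\<^sub>2 \<longleftrightarrow>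
     smooth_point (frontier \<Omega>) (\<gamma> t) \<and>
     unit_speed_segment N \<gamma> t\<^sub>1 t \<and> unit_speed_segment N \<gamma> t t\<^sub>2 \<and>
     critical_point_on (\<lambda>x. N (x - \<gamma> t\<^sub>1) + N (\<gamma> t\<^sub>2 - x)) (frontier \<Omega>) (\<gamma> t)"

definition billiard_trajectory ::
  "('a::euclidean_space \<Rightarrow> real) \<Rightarrow> 'a set \<Rightarrow> real set \<Rightarrow> (real \<Rightarrow> 'a) \<Rightarrow> bool" where
  "billiard_trajectory N \<Omega> I \<gamma> \<longleftrightarrow>
     is_interval I \<and> continuous_on I \<gamma> \<and> \<gamma> ` I \<subseteq> closure \<Omega> \<and>
     (\<forall>t\<in>interior I. \<exists>\<delta>>0. {t - \<delta><..<t + \<delta>} \<subseteq> I \<and>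
        (\<forall>t\<^sub>1\<in>{t - \<delta><..<t}. \<forall>t\<^sub>2\<in>{t<..<t + \<delta>}.
           unit_speed_segment N \<gamma> t\<^sub>1 t\<^sub>2 \<or> reflects_at N \<Omega> \<gamma> t\<^sub>1 t t\<^sub>2))"

definition reflection_moments ::
  "('a::euclidean_space \<Rightarrow> real) \<Rightarrow> 'a set \<Rightarrow> real set \<Rightarrow> (real \<Rightarrow> 'a) \<Rightarrow> real set" where
  "reflection_moments N \<Omega> I \<gamma> =
     {t\<in>interior I. \<exists>\<delta>>0. {t - \<delta><..<t + \<delta>} \<subseteq> I \<and>
        (\<forall>t\<^sub>1\<in>{t - \<delta><..<t}. \<forall>t\<^sub>2\<in>{t<..<t + \<delta>}.
           \<not> unit_speed_segment N \<gamma> t\<^sub>1 t\<^sub>2 \<and> reflects_at N \<Omega> \<gamma> t\<^sub>1 t t\<^sub>2)}"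

definition wall :: "'a::euclidean_space set \<Rightarrow> bool" where
  "wall W \<longleftrightarrow>
     closed W \<and> convex W \<and> interior W \<noteq> {} \<and> (\<forall>p\<in>frontier W. smooth_point (frontier W) p)"

text \<open>The table \<open>\<Omega>\<close> is automatically open. It is not required to be connected.\<close>

definition semi_dispersing_minkowski_billiard ::
  "('a::euclidean_space \<Rightarrow> real) \<Rightarrow> 'a set \<Rightarrow> bool" where
  "semi_dispersing_minkowski_billiard N \<Omega> \<longleftrightarrow>
     minkowski_norm N \<and>
     (\<exists>(m::nat) W. (\<forall>i\<in>{1..m}. wall (W i)) \<and> \<Omega> = UNIV - (\<Union>i\<in>{1..m}. W i))"

end

theory Submission imports Defs begin

text \<open>
  Attach to each unit velocity \<open>v\<close> its momentum, the differential of \<open>N\<close> at \<open>v\<close>. If a trajectory is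
  reflected at a point \<open>x\<close>, criticality of the length function says that the jump of the momentum is
  conormal to the boundary of the table at \<open>x\<close>. Strict convexity of \<open>N\<close> determines its direction: the
  jump points out of the wall, so it is nonnegative on \<open>x - q\<close> for every point \<open>q\<close> of a wall containing
  \<open>x\<close> (\<open>momentum_jump_at_reflection\<close>).

  By the definition of a trajectory, infinitely many reflection moments in bounded time accumulate at an
  endpoint \<open>T\<close> of the time interval. The trajectory has unit speed and so converges to a point \<open>p\<close> at
  \<open>T\<close>, and the walls hit shortly before or after \<open>T\<close> all contain \<open>p\<close>. Let \<open>\<phi>\<close> be the momentum of the
  current velocity evaluated at \<open>\<gamma> - p\<close>. Along a segment \<open>\<phi>\<close> has derivative \<open>1\<close>, and at a reflection it
  does not decrease, by the sign of the jump with \<open>q = p\<close> (\<open>momentum_growth\<close>). As \<open>\<phi>\<close> tends to \<open>0\<close> at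
  \<open>T\<close>, this gives \<open>\<bar>\<phi> t\<bar> \<ge> \<bar>t - T\<bar>\<close>. But a momentum never exceeds \<open>N\<close>, and the displacement between \<open>\<gamma> t\<close>
  and \<open>p\<close> has \<open>N\<close>-length at most \<open>\<bar>t - T\<bar>\<close>. So equality holds throughout, and the equality case for a
  strictly convex norm says that the displacement has the direction of the velocity
  (\<open>ray_through_endpoint\<close>). The trajectory therefore runs straight into or out of \<open>p\<close> near \<open>T\<close> and has no
  reflections there, a contradiction.

  The sign of the jump needs the tangent hyperplane of the boundary of the table at \<open>x\<close>, where several walls
  may meet, to be the tangent hyperplane of each wall through \<open>x\<close>. It suffices to
  compare the hyperplane with the directions that enter the interior of the wall
  (\<open>critical_covector_supports_wall\<close>).
\<close>

section \<open>Momenta in a Minkowski space\<close>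

text \<open>The momentum of a unit vector \<open>v\<close> is the differential of \<open>N\<close> at \<open>v\<close>, that is, the Legendre dual
  covector: it is at most \<open>N\<close> everywhere and equals \<open>N\<close> at \<open>v\<close>.\<close>

abbreviation momentum :: "('a::euclidean_space \<Rightarrow> real) \<Rightarrow> 'a \<Rightarrow> 'a \<Rightarrow> real" where
  "momentum N v \<equiv> frechet_derivative N (at v)"

lemma minkowski_norm_zero:
  assumes "minkowski_norm N" shows "N 0 = 0"
  using assms unfolding minkowski_norm_def by (metis mult_zero_left order_refl scaleR_zero_left)

lemma minkowski_norm_pos:
  assumes "minkowski_norm N" "x \<noteq> 0" shows "N x > 0"
  using assms unfolding minkowski_norm_def by blast

lemma minkowski_norm_scale:
  assumes "minkowski_norm N" "t \<ge> 0" shows "N (t *\<^sub>R x) = t * N x"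
  using assms unfolding minkowski_norm_def by blast

lemma minkowski_norm_triangle:
  assumes "minkowski_norm N" shows "N (x + y) \<le> N x + N y"
  using assms unfolding minkowski_norm_def by blast

lemma minkowski_norm_tendsto:
  assumes "minkowski_norm N" "(f \<longlongrightarrow> l) F" shows "((\<lambda>s. N (f s)) \<longlongrightarrow> N l) F"
  using assms unfolding minkowski_norm_def by (auto intro: continuous_on_tendsto_compose)

lemma unit_vector_nonzero:
  assumes "minkowski_norm N" "N v = 1" shows "v \<noteq> 0"
  using assms minkowski_norm_zero by fastforce

text \<open>By compactness of the Euclidean unit sphere. The estimate turns the unit speed of a trajectory,
  which is measured by the asymmetric \<open>N\<close>, into metric completeness arguments.\<close>

lemma norm_le_minkowski_norm:
  fixes N :: "'a::euclidean_space \<Rightarrow> real"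
  assumes N: "minkowski_norm N"
  obtains C where "C \<ge> 0" "\<And>x. norm x \<le> C * N x"
proof -
  have "sphere (0::'a) 1 \<noteq> {}" by simp
  moreover have "continuous_on (sphere 0 1) N"
    using N unfolding minkowski_norm_def by (blast intro: continuous_on_subset)
  ultimately obtain x0 where x0: "norm x0 = 1" and min: "\<And>x. norm x = 1 \<Longrightarrow> N x0 \<le> N x"
    using continuous_attains_inf[of "sphere 0 1" N] by auto
  have "x0 \<noteq> 0" using x0 by auto
  then have pos: "N x0 > 0" using minkowski_norm_pos[OF N] by blast
  have "norm x \<le> (1 / N x0) * N x" for x
  proof (cases "x = 0")
    case True then show ?thesis using minkowski_norm_zero[OF N] by simp
  next
    case False
    then have "N x0 \<le> N ((1 / norm x) *\<^sub>R x)" by (intro min) simp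
    also have "\<dots> = N x / norm x" using minkowski_norm_scale[OF N, of "1 / norm x" x] by simp
    finally show ?thesis using False pos by (simp add: field_simps)
  qed
  then show ?thesis using pos that[of "1 / N x0"] by simp
qed

lemma has_derivative_momentum:
  assumes "minkowski_norm N" "v \<noteq> 0"
  shows "(N has_derivative momentum N v) (at v)"
proof -
  obtain N' where "C1_with_derivative N N' (- {0})"
    using assms(1) unfolding minkowski_norm_def by blast
  then have "N differentiable (at v)"
    using assms(2) unfolding C1_with_derivative_def differentiable_def by blast
  then show ?thesis by (simp add: frechet_derivative_works)
qed

lemma linear_momentum:
  assumes "minkowski_norm N" "v \<noteq> 0" shows "linear (momentum N v)"
  using has_derivative_momentum[OF assms] has_derivative_linear by blast

text \<open>The critical point condition differentiates \<open>N\<close> at displacement vectors along the trajectory; this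
  homogeneity replaces them by the unit velocities.\<close>

lemma momentum_scale:
  assumes N: "minkowski_norm N" "v \<noteq> 0" and c: "c > 0"
  shows "momentum N (c *\<^sub>R v) = momentum N v"
proof -
  have "((\<lambda>y. N (c *\<^sub>R y)) has_derivative (\<lambda>y. momentum N (c *\<^sub>R v) (c *\<^sub>R y))) (at v)"
    using has_derivative_momentum[OF N(1), of "c *\<^sub>R v"] N(2) c
    by (intro has_derivative_compose[where g = N and f = "\<lambda>y. c *\<^sub>R y"]) (auto intro!: derivative_eq_intros)
  moreover have "((\<lambda>y. N (c *\<^sub>R y)) has_derivative (\<lambda>y. c * momentum N v y)) (at v)"
    using has_derivative_mult_right[OF has_derivative_momentum[OF N], of c] 
      minkowski_norm_scale[OF N(1), of c] c by simp
  ultimately have eq: "(\<lambda>y. momentum N (c *\<^sub>R v) (c *\<^sub>R y)) = (\<lambda>y. c * momentum N v y)"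
    using has_derivative_unique by blast
  show ?thesis
  proof
    fix y
    have "c * momentum N (c *\<^sub>R v) y = momentum N (c *\<^sub>R v) (c *\<^sub>R y)"
      using linear_momentum[OF N(1), of "c *\<^sub>R v"] N(2) c by (simp add: linear_scale)
    also have "\<dots> = c * momentum N v y" by (rule fun_cong[OF eq])
    finally show "momentum N (c *\<^sub>R v) y = momentum N v y" using c by simp
  qed
qed

lemma has_derivative_along_line:
  assumes "(f has_derivative f') (at x)"
  shows "((\<lambda>s. f (x + s *\<^sub>R k)) has_real_derivative f' k) (at 0)"
proof -
  have "((\<lambda>s. f (x + s *\<^sub>R k)) has_derivative (\<lambda>s. f' (s *\<^sub>R k))) (at 0)"
    using assms by (intro has_derivative_compose[where g = f and f = "\<lambda>s. x + s *\<^sub>R k"])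
      (auto intro!: derivative_eq_intros)
  then show ?thesis using has_derivative_linear[OF assms]
    by (simp add: has_field_derivative_def linear_scale mult.commute[of _ "f' k"])
qed

lemma momentum_le:
  assumes N: "minkowski_norm N" and x: "x \<noteq> 0"
  shows "momentum N x y \<le> N y"
proof (rule ccontr)
  assume "\<not> ?thesis"
  moreover have "((\<lambda>s. N (x + s *\<^sub>R y) - s * N y) has_real_derivative (momentum N x y - N y)) (at 0)"
    using has_derivative_along_line[OF has_derivative_momentum[OF N x], of y]
    by (auto intro!: derivative_eq_intros)
  ultimately obtain d where "d > 0"
    and d: "\<And>h. h > 0 \<Longrightarrow> h < d \<Longrightarrow> N x < N (x + h *\<^sub>R y) - h * N y"
    by (auto dest!: DERIV_pos_inc_right)
  have "N (x + (d/2) *\<^sub>R y) \<le> N x + (d/2) * N y"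
    using minkowski_norm_triangle[OF N, of x "(d/2) *\<^sub>R y"] minkowski_norm_scale[OF N, of "d/2" y]
      \<open>d > 0\<close> by simp
  then show False using d[of "d/2"] \<open>d > 0\<close> by simp
qed

lemma momentum_self:
  assumes N: "minkowski_norm N" and x: "x \<noteq> 0"
  shows "momentum N x x = N x"
proof (rule antisym[OF momentum_le[OF assms]], rule ccontr)
  assume "\<not> N x \<le> momentum N x x"
  moreover have "((\<lambda>s. (1 + s) * N x - N (x + s *\<^sub>R x)) has_real_derivative (N x - momentum N x x)) (at 0)"
    using has_derivative_along_line[OF has_derivative_momentum[OF N x], of x]
    by (auto intro!: derivative_eq_intros)
  ultimately obtain d where "d > 0"
    and d: "\<And>h. h > 0 \<Longrightarrow> h < d \<Longrightarrow> 0 < (1 + h) * N x - N (x + h *\<^sub>R x)"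
    by (auto dest!: DERIV_pos_inc_right)
  have "N (x + (d/2) *\<^sub>R x) = (1 + d/2) * N x"
    using minkowski_norm_scale[OF N, of "1 + d/2" x] \<open>d > 0\<close> by (simp add: scaleR_add_left)
  then show False using d[of "d/2"] \<open>d > 0\<close> by simp
qed

text \<open>This is the equality case of \<open>momentum N v \<le> N\<close>: the function \<open>N\<close> would be constant on the
  segment from \<open>v\<close> to \<open>x / r\<close>, since it is at most \<open>1\<close> there by convexity and at least \<open>1\<close> by the
  supporting covector, so strict convexity makes the segment trivial.\<close>

lemma eq_scaled_velocity_if_momentum_ge:
  assumes N: "minkowski_norm N" and v: "N v = 1"
    and r: "r > 0" and le: "N x \<le> r" and ge: "momentum N v x \<ge> r"
  shows "x = r *\<^sub>R v"
proof -
  have v0: "v \<noteq> 0" using unit_vector_nonzero N v by blast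
  define u where "u = (1/r) *\<^sub>R x"
  have lin: "linear (momentum N v)" using linear_momentum N v0 by blast
  have u1: "N u \<le> 1" using minkowski_norm_scale[OF N, of "1/r" x] r le by (simp add: u_def)
  have u2: "momentum N v u \<ge> 1" using r ge by (simp add: u_def linear_scale[OF lin])
  have "N z = 1" if z: "z \<in> closed_segment v u" for z
  proof -
    obtain c where c: "0 \<le> c" "c \<le> 1" and zc: "z = (1 - c) *\<^sub>R v + c *\<^sub>R u"
      using z by (auto simp: closed_segment_def)
    have "N z \<le> (1 - c) * N v + c * N u"
      using minkowski_norm_triangle[OF N, of "(1 - c) *\<^sub>R v" "c *\<^sub>R u"] c
      by (simp add: zc minkowski_norm_scale[OF N])
    also have "\<dots> \<le> (1 - c) + c * 1" using v u1 c by (intro add_mono mult_left_mono) auto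
    finally have "N z \<le> 1" by simp
    have "momentum N v z = (1 - c) + c * momentum N v u"
      using momentum_self[OF N v0] v by (simp add: zc linear_add[OF lin] linear_scale[OF lin])
    also have "\<dots> \<ge> (1 - c) + c * 1" using u2 c by (intro add_mono mult_left_mono) auto
    finally have "1 \<le> momentum N v z" by simp
    with \<open>N z \<le> 1\<close> show ?thesis using momentum_le[OF N v0, of z] by simp
  qed
  then have "closed_segment v u \<subseteq> {z. N z = 1}" by blast
  then have "v = u" using N unfolding minkowski_norm_def by blast
  then show ?thesis using r by (simp add: u_def)
qed

lemma momentum_less_1:
  assumes N: "minkowski_norm N" and "N v = 1" "N w = 1" "v \<noteq> w"
  shows "momentum N v w < 1"
proof (rule ccontr)
  assume "\<not> ?thesis"
  then have "w = 1 *\<^sub>R v" using assms by (intro eq_scaled_velocity_if_momentum_ge[OF N]) auto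
  then show False using \<open>v \<noteq> w\<close> by simp
qed

section \<open>Hypersurfaces and convex bodies to first order\<close>

lemma eventually_scaled_in_open:
  fixes p :: "'a::real_normed_vector"
  assumes "open U" "p \<in> U" "bounded K"
  shows "\<forall>\<^sub>F s in at_right (0::real). \<forall>k\<in>K. p + s *\<^sub>R k \<in> U"
proof -
  obtain r where r: "r > 0" "ball p r \<subseteq> U" using assms open_contains_ball by blast
  obtain M where M: "M > 0" "\<And>k. k \<in> K \<Longrightarrow> norm k \<le> M" using assms(3) bounded_pos by blast
  have "\<forall>k\<in>K. p + s *\<^sub>R k \<in> U" if s: "0 < s" "s < r / M" for s
  proof
    fix k assume "k \<in> K"
    then have "norm (s *\<^sub>R k) \<le> s * M" using M s by simp
    also have "\<dots> < r" using s M by (simp add: field_simps)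
    finally have "p + s *\<^sub>R k \<in> ball p r" by (simp add: dist_norm)
    then show "p + s *\<^sub>R k \<in> U" using r by blast
  qed
  then show ?thesis using r M
    by (intro eventually_at_rightI[of 0 "r/M"]) auto
qed

text \<open>The same small \<open>s\<close> serves for all directions in the bounded set \<open>K\<close>, so that a whole segment of
  directions can be followed at once.\<close>

lemma eventually_pos_along:
  fixes g :: "'a::real_normed_vector \<Rightarrow> real"
  assumes g: "(g has_derivative g') (at p)" "g p = 0"
    and K: "bounded K" "\<beta> > 0" "\<And>k. k \<in> K \<Longrightarrow> g' k \<ge> \<beta>"
  shows "\<forall>\<^sub>F s in at_right (0::real). \<forall>k\<in>K. g (p + s *\<^sub>R k) > 0"
proof -
  obtain M where M: "M > 0" "\<And>k. k \<in> K \<Longrightarrow> norm k \<le> M" using K(1) bounded_pos by blast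
  define e where "e = \<beta> / (2 * M)"
  have "e > 0" using K M by (simp add: e_def)
  then obtain d where d: "d > 0" "\<And>y. norm (y - p) < d \<Longrightarrow> norm (g y - g p - g' (y - p)) \<le> e * norm (y - p)"
    using g(1) unfolding has_derivative_at_alt by blast
  have "g (p + s *\<^sub>R k) > 0" if k: "k \<in> K" and s: "0 < s" and near: "p + s *\<^sub>R k \<in> ball p d" for s k
  proof -
    have lin: "g' (s *\<^sub>R k) = s * g' k" using has_derivative_linear[OF g(1)] by (simp add: linear_scale)
    have "norm (g (p + s *\<^sub>R k) - g p - g' (s *\<^sub>R k)) \<le> e * norm (s *\<^sub>R k)"
      using d(2)[of "p + s *\<^sub>R k"] near by (simp add: dist_norm)
    also have "\<dots> \<le> e * (s * M)" using M(2)[OF k] s \<open>e > 0\<close> by simp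
    also have "\<dots> = s * \<beta> / 2" using M by (simp add: e_def)
    finally have "g (p + s *\<^sub>R k) \<ge> s * g' k - s * \<beta> / 2" using g(2) lin unfolding real_norm_def by linarith
    moreover have "s * g' k \<ge> s * \<beta>" using K(3)[OF k] s by simp
    moreover have "s * \<beta> > 0" using s K by simp
    ultimately show ?thesis by linarith
  qed
  moreover have "\<forall>\<^sub>F s in at_right (0::real). \<forall>k\<in>K. p + s *\<^sub>R k \<in> ball p d"
    using d K by (intro eventually_scaled_in_open) auto
  moreover have "\<forall>\<^sub>F s in at_right (0::real). 0 < s" by (simp add: eventually_at_right_less)
  ultimately show ?thesis by (elim eventually_rev_mp) (auto elim: eventually_mono)
qed

text \<open>Move from \<open>h\<close> a little in both directions along a vector \<open>u\<close> transverse to the hypersurface. For small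
  \<open>s\<close> the defining function has opposite signs at the two ends, so it vanishes in between. This
  replaces the implicit function theorem.\<close>

lemma hypersurface_meets_tangent_direction:
  assumes def: "C1_defining_function S U g g'" and p: "p \<in> U" "p \<in> S"
    and h: "g' p h = 0" and e: "e > 0"
  shows "\<exists>s k. 0 < s \<and> s < e \<and> dist k h < e \<and> p + s *\<^sub>R k \<in> S"
proof -
  have U: "open U" and g: "(g has_derivative g' p) (at p)" and ne: "g' p \<noteq> 0"
    and S: "S \<inter> U = {x\<in>U. g x = 0}"
    and der: "\<And>x. x \<in> U \<Longrightarrow> (g has_derivative g' x) (at x)"
    using def p unfolding C1_defining_function_def C1_with_derivative_def by auto
  have gp: "g p = 0" using S p by blast
  obtain u0 where u0: "g' p u0 \<noteq> 0" using ne by (metis blinfun_eqI zero_blinfun.rep_eq)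
  define u where "u = (1 / g' p u0) *\<^sub>R u0"
  have u: "g' p u = 1" using u0 by (simp add: u_def blinfun.scaleR_right)
  then have "u \<noteq> 0" by auto
  define \<tau> where "\<tau> = e / (2 * norm u)"
  have \<tau>: "\<tau> > 0" "\<tau> * norm u < e" using \<open>u \<noteq> 0\<close> e by (auto simp: \<tau>_def)
  define K where "K = (\<lambda>\<theta>. h + \<theta> *\<^sub>R u) ` {-\<tau>..\<tau>}"
  have K: "bounded K" unfolding K_def
    by (intro compact_imp_bounded compact_continuous_image continuous_intros) auto
  have ev1: "\<forall>\<^sub>F s in at_right (0::real). \<forall>k\<in>{h + \<tau> *\<^sub>R u}. g (p + s *\<^sub>R k) > 0"
    by (rule eventually_pos_along[OF g gp, where \<beta> = \<tau>])
      (use h u \<tau> in \<open>auto simp: blinfun.add_right blinfun.scaleR_right\<close>)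
  have ev2: "\<forall>\<^sub>F s in at_right (0::real). \<forall>k\<in>{h - \<tau> *\<^sub>R u}. - g (p + s *\<^sub>R k) > 0"
    by (rule eventually_pos_along[OF has_derivative_minus[OF g], where \<beta> = \<tau>])
      (use h u \<tau> gp in \<open>auto simp: blinfun.diff_right blinfun.scaleR_right\<close>)
  have ev3: "\<forall>\<^sub>F s in at_right (0::real). 0 < s \<and> s < e"
    using e by (intro eventually_at_rightI[of 0 e]) auto
  have "\<forall>\<^sub>F s in at_right (0::real). g (p + s *\<^sub>R (h + \<tau> *\<^sub>R u)) > 0 \<and> g (p + s *\<^sub>R (h - \<tau> *\<^sub>R u)) < 0
      \<and> 0 < s \<and> s < e \<and> (\<forall>k\<in>K. p + s *\<^sub>R k \<in> U)"
    using ev1 ev2 ev3 eventually_scaled_in_open[OF U p(1) K] by eventually_elim auto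
  then obtain s where s: "g (p + s *\<^sub>R (h + \<tau> *\<^sub>R u)) > 0" "g (p + s *\<^sub>R (h - \<tau> *\<^sub>R u)) < 0"
      "0 < s" "s < e" "\<forall>k\<in>K. p + s *\<^sub>R k \<in> U"
    using eventually_happens' trivial_limit_at_right_real by blast
  have "continuous_on {-\<tau>..\<tau>} (\<lambda>\<theta>. g (p + s *\<^sub>R (h + \<theta> *\<^sub>R u)))"
  proof (rule continuous_on_compose2[of U g])
    show "continuous_on U g" using der has_derivative_continuous
      by (blast intro: continuous_at_imp_continuous_on)
  qed (use s in \<open>auto simp: K_def intro!: continuous_intros\<close>)
  then obtain \<theta> where \<theta>: "-\<tau> \<le> \<theta>" "\<theta> \<le> \<tau>" "g (p + s *\<^sub>R (h + \<theta> *\<^sub>R u)) = 0"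
    using IVT'[of "\<lambda>\<theta>. g (p + s *\<^sub>R (h + \<theta> *\<^sub>R u))" "-\<tau>" 0 \<tau>] s \<tau> by auto
  have "p + s *\<^sub>R (h + \<theta> *\<^sub>R u) \<in> S" using S \<theta> s by (auto simp: K_def)
  moreover have "dist (h + \<theta> *\<^sub>R u) h < e"
  proof -
    have "\<bar>\<theta>\<bar> * norm u \<le> \<tau> * norm u" using \<theta> by (intro mult_right_mono) auto
    then show ?thesis using \<tau> by (simp add: dist_norm)
  qed
  ultimately show ?thesis using s by blast
qed

text \<open>For convex \<open>W\<close> with \<open>p \<in> W\<close> this is the open cone of directions pointing from \<open>p\<close> into the interior
  of \<open>W\<close>.\<close>

definition entering_directions :: "'a::euclidean_space set \<Rightarrow> 'a \<Rightarrow> 'a set" where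
  "entering_directions W p = {z. \<exists>s>0. p + s *\<^sub>R z \<in> interior W}"

lemma interior_along_entering_direction:
  fixes W :: "'a::euclidean_space set"
  assumes "convex W" "p \<in> W" "p + s *\<^sub>R z \<in> interior W" "0 < r" "r \<le> s"
  shows "p + r *\<^sub>R z \<in> interior W"
  using mem_interior_convex_shrink[OF assms(1,3,2), of "r / s"] assms(4,5)
  by (simp add: field_simps)

text \<open>If a tangent direction of \<open>S\<close> entered \<open>W\<close>, then so would all nearby directions, uniformly for small
  positive times; but some of these lead to points of \<open>S\<close>. The lemma is applied both to
  \<open>S = frontier W\<close> and to the boundary of the table, and so transfers the tangent hyperplane from one
  to the other without describing how the walls fit together near \<open>p\<close>.\<close>

lemma tangent_not_entering:
  assumes def: "C1_defining_function S U g g'" and p: "p \<in> U" "p \<in> S"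
    and W: "convex W" "p \<in> W" and disj: "S \<inter> interior W = {}"
    and h: "g' p h = 0"
  shows "h \<notin> entering_directions W p"
proof
  assume "h \<in> entering_directions W p"
  then obtain s where s: "s > 0" "p + s *\<^sub>R h \<in> interior W" unfolding entering_directions_def by blast
  have "open ((\<lambda>k. p + s *\<^sub>R k) -` interior W)" by (intro open_vimage continuous_intros) auto
  then obtain d where "d > 0" "ball h d \<subseteq> (\<lambda>k. p + s *\<^sub>R k) -` interior W"
    using s(2) by (auto elim: openE)
  then have d: "d > 0" "\<And>k. dist k h < d \<Longrightarrow> p + s *\<^sub>R k \<in> interior W"
    by (auto simp: subset_iff dist_commute)
  obtain r k where rk: "0 < r" "r < min d s" "dist k h < min d s" "p + r *\<^sub>R k \<in> S"
    using hypersurface_meets_tangent_direction[OF def p h, of "min d s"] d s by auto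
  then have "p + r *\<^sub>R k \<in> interior W"
    using interior_along_entering_direction[OF W d(2)] by auto
  then show False using disj rk by blast
qed

text \<open>Smoothness of the boundary makes the cone of entering directions as large as convexity allows. Joining
  \<open>z\<close> to \<open>u\<close> inside the half space gives a short segment near \<open>p\<close> on which the defining function has
  no zero. It misses the boundary of \<open>W\<close> and one end is interior, hence so is the other.\<close>

lemma entering_directions_halfspace:
  assumes def: "C1_defining_function (frontier W) U g g'" and p: "p \<in> U" "p \<in> frontier W"
    and W: "closed W" "convex W" and u: "u \<in> entering_directions W p"
    and z: "g' p u * g' p z > 0"
  shows "z \<in> entering_directions W p"
proof -
  define c where "c = g' p u"
  have U: "open U" and g: "(g has_derivative g' p) (at p)"
    and S: "frontier W \<inter> U = {x\<in>U. g x = 0}"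
    using def p unfolding C1_defining_function_def C1_with_derivative_def by auto
  have gp: "g p = 0" using S p by blast
  have pW: "p \<in> W" using p W frontier_subset_closed by blast
  obtain r where r: "r > 0" "p + r *\<^sub>R u \<in> interior W" using u unfolding entering_directions_def by blast
  have K: "bounded (closed_segment z u)" by (simp add: compact_imp_bounded)
  have c: "c \<noteq> 0" using z by (auto simp: c_def)
  define \<beta> where "\<beta> = min (c * g' p z) (c * c)"
  have beta: "\<beta> > 0" using z c by (auto simp: \<beta>_def c_def mult.commute not_sum_power2_lt_zero zero_less_mult_iff)
  have "\<forall>\<^sub>F s in at_right (0::real). \<forall>k\<in>closed_segment z u. c * g (p + s *\<^sub>R k) > 0"
  proof (rule eventually_pos_along[OF has_derivative_mult_right[OF g] _ K beta])
    fix k assume "k \<in> closed_segment z u"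
    then obtain t where t: "0 \<le> t" "t \<le> 1" "k = (1 - t) *\<^sub>R z + t *\<^sub>R u"
      by (auto simp: closed_segment_def)
    have "g' p k = (1 - t) * g' p z + t * c"
      unfolding t(3) by (simp only: blinfun.add_right blinfun.scaleR_right c_def real_scaleR_def)
    then have "c * g' p k = (1 - t) * (c * g' p z) + t * (c * c)" by algebra
    moreover have "(1 - t) * \<beta> + t * \<beta> \<le> (1 - t) * (c * g' p z) + t * (c * c)"
      using t by (intro add_mono mult_left_mono) (auto simp: \<beta>_def)
    ultimately show "\<beta> \<le> c * g' p k" by (simp add: algebra_simps)
  qed (simp add: gp)
  moreover have "\<forall>\<^sub>F s in at_right (0::real). 0 < s \<and> s < r"
    using r by (intro eventually_at_rightI[of 0 r]) auto
  ultimately have "\<forall>\<^sub>F s in at_right (0::real). (\<forall>k\<in>closed_segment z u. c * g (p + s *\<^sub>R k) > 0)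
      \<and> (0 < s \<and> s < r) \<and> (\<forall>k\<in>closed_segment z u. p + s *\<^sub>R k \<in> U)"
    using eventually_scaled_in_open[OF U p(1) K] by eventually_elim auto
  then obtain s where s: "\<forall>k\<in>closed_segment z u. c * g (p + s *\<^sub>R k) > 0" "0 < s" "s < r"
      "\<forall>k\<in>closed_segment z u. p + s *\<^sub>R k \<in> U"
    using eventually_happens' trivial_limit_at_right_real by blast
  define L where "L = (\<lambda>k. p + s *\<^sub>R k) ` closed_segment z u"
  have "connected L" unfolding L_def by (intro connected_continuous_image continuous_intros) auto
  moreover have "L \<inter> frontier (interior W) = {}"
  proof -
    have "p + s *\<^sub>R k \<notin> frontier W" if "k \<in> closed_segment z u" for k
    proof -
      have "p + s *\<^sub>R k \<in> U" "g (p + s *\<^sub>R k) \<noteq> 0" using s(1,4) that by force+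
      then show ?thesis using S by blast
    qed
    then have "L \<inter> frontier W = {}" unfolding L_def by blast
    then show ?thesis using frontier_interior_subset by blast
  qed
  moreover have "p + s *\<^sub>R u \<in> L \<inter> interior W"
    using interior_along_entering_direction[OF W(2) pW r(2), of s] s by (auto simp: L_def)
  ultimately have "L - interior W = {}" using connected_Int_frontier by blast
  then have "p + s *\<^sub>R z \<in> interior W" by (auto simp: L_def)
  then show ?thesis using s unfolding entering_directions_def by blast
qed

text \<open>The kernel of \<open>A\<close> is the tangent hyperplane of \<open>S\<close>, which contains no entering direction of \<open>W\<close>, while
  the entering directions form a half space. So \<open>A\<close> has constant sign on entering directions, and
  the direction \<open>z\<close> rules out the positive one. In the application \<open>S\<close> is the boundary of the table,
  \<open>A\<close> is the jump of the momentum at a reflection, and \<open>z\<close> is an outgoing or a reversed incoming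
  velocity.\<close>

lemma critical_covector_supports_wall:
  assumes W: "wall W" and S: "smooth_point S p" and disj: "S \<inter> interior W = {}" and pW: "p \<in> W"
    and A: "linear A" and vanish: "\<And>h. h \<in> tangent_space S p \<Longrightarrow> A h = (0::real)"
    and z: "A z > 0" "z \<notin> entering_directions W p" and q: "q \<in> W"
  shows "A (q - p) \<le> 0"
proof (rule ccontr)
  assume "\<not> ?thesis"
  then have pos: "A (q - p) > 0" by simp
  have cW: "closed W" and vW: "convex W" and iW: "interior W \<noteq> {}"
    using W unfolding wall_def by auto
  have pS: "p \<in> S" using S unfolding smooth_point_def by blast
  obtain U g g' where p: "p \<in> U" and def: "C1_defining_function S U g g'"
    using S unfolding smooth_point_def by blast
  have pF: "p \<in> frontier W" using pS disj pW cW by (auto simp: frontier_def)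
  obtain V k k' where pV: "p \<in> V" and def': "C1_defining_function (frontier W) V k k'"
    using W pF unfolding wall_def smooth_point_def by blast
  \<comment> \<open>The kernel of \<open>A\<close> contains that of \<open>g' p\<close>, and both are hyperplanes because \<open>A z > 0\<close> excludes \<open>A = 0\<close>.\<close>
  have tan: "g' p h = 0" if "A h = 0" for h
  proof -
    have "g' p \<noteq> 0" using def p unfolding C1_defining_function_def by blast
    then obtain e where e: "g' p e \<noteq> 0" by (metis blinfun_eqI zero_blinfun.rep_eq)
    have *: "A x = g' p x / g' p e * A e" for x
    proof -
      have "g' p (x - (g' p x / g' p e) *\<^sub>R e) = 0"
        using e by (simp add: blinfun.diff_right blinfun.scaleR_right)
      then have "x - (g' p x / g' p e) *\<^sub>R e \<in> tangent_space S p"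
        using p def unfolding tangent_space_def by blast
      then have "A (x - (g' p x / g' p e) *\<^sub>R e) = 0" by (rule vanish)
      then show ?thesis by (simp add: linear_diff[OF A] linear_scale[OF A])
    qed
    have "A e \<noteq> 0" using *[of z] z(1) by auto
    then show ?thesis using *[of h] that e by simp
  qed
  \<comment> \<open>A small move of \<open>q\<close> towards the interior point \<open>c\<close> keeps \<open>A\<close> positive and makes \<open>u\<close> an entering direction.\<close>
  obtain c where c: "c \<in> interior W" using iW by blast
  have "((\<lambda>e. A (q - p) - e * A (q - c)) \<longlongrightarrow> A (q - p) - 0 * A (q - c)) (at_right 0)"
    by (intro tendsto_intros)
  then have "\<forall>\<^sub>F e in at_right 0. A (q - p) - e * A (q - c) > 0"
    using pos by (intro order_tendstoD(1)) auto
  then have "\<forall>\<^sub>F e in at_right 0. A ((q - p) - e *\<^sub>R (q - c)) > 0"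
    by (simp add: linear_diff[OF A] linear_scale[OF A])
  moreover have "\<forall>\<^sub>F e in at_right (0::real). 0 < e \<and> e \<le> 1"
    by (intro eventually_at_rightI[of 0 1]) auto
  ultimately have "\<forall>\<^sub>F e in at_right 0. A ((q - p) - e *\<^sub>R (q - c)) > 0 \<and> 0 < e \<and> e \<le> 1"
    by (rule eventually_conj)
  then obtain e where e: "A ((q - p) - e *\<^sub>R (q - c)) > 0" "0 < e" "e \<le> 1"
    using eventually_happens' trivial_limit_at_right_real by blast
  define u where "u = (q - p) - e *\<^sub>R (q - c)"
  have u: "u \<in> entering_directions W p"
    unfolding entering_directions_def using mem_interior_convex_shrink[OF vW c q e(2,3)]
    by (auto intro!: exI[of _ 1] simp: u_def)
  have Au: "A u > 0" using e by (simp add: u_def)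
  have no: "h \<notin> entering_directions W p" if "A h = 0" for h
    using tangent_not_entering[OF def p pS vW pW disj] tan[OF that] by blast
  have k0: "k' p u \<noteq> 0"
    using tangent_not_entering[OF def' pV pF vW pW] u by (auto simp: frontier_def)
  define h where "h = z - (A z / A u) *\<^sub>R u"
  have Ah: "A h = 0" using Au by (simp add: h_def linear_diff[OF A] linear_scale[OF A])
  \<comment> \<open>Neither \<open>h\<close> nor \<open>- h\<close> enters \<open>W\<close>, so \<open>h\<close> lies in the tangent hyperplane of \<open>W\<close>.\<close>
  have "k' p u * k' p h \<le> 0"
    using entering_directions_halfspace[OF def' pV pF cW vW u, of h] no[OF Ah] by force
  moreover have "k' p u * k' p (- h) \<le> 0"
    using entering_directions_halfspace[OF def' pV pF cW vW u, of "- h"] no[of "- h"] Ah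
    by (force simp: linear_neg[OF A])
  ultimately have "k' p u * k' p h = 0" by (simp add: blinfun.minus_right)
  then have "k' p h = 0" using k0 by simp
  then have "k' p z = (A z / A u) * k' p u"
    by (simp add: h_def blinfun.diff_right blinfun.scaleR_right)
  then have "k' p u * k' p z = (A z / A u) * (k' p u * k' p u)" by simp
  moreover have "k' p u * k' p u > 0" using k0 not_real_square_gt_zero by blast
  then have "(A z / A u) * (k' p u * k' p u) > 0"
    using z(1) Au by (intro mult_pos_pos[OF divide_pos_pos])
  ultimately have "k' p u * k' p z > 0" by simp
  then show False
    using entering_directions_halfspace[OF def' pV pF cW vW u] z(2) by blast
qed

section \<open>Velocities of a broken line\<close>

text \<open>Both one-sided velocities are recorded, also where they agree, so that moments with and without a
  reflection are treated alike.\<close>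

definition polygonal_at :: "(real \<Rightarrow> 'a::real_normed_vector) \<Rightarrow> real \<Rightarrow> real \<Rightarrow> 'a \<Rightarrow> 'a \<Rightarrow> bool" where
  "polygonal_at \<gamma> t \<delta> w v \<longleftrightarrow> \<delta> > 0 \<and>
     (\<forall>s\<in>{t - \<delta>..t}. \<gamma> s = \<gamma> t + (s - t) *\<^sub>R w) \<and>
     (\<forall>s\<in>{t..t + \<delta>}. \<gamma> s = \<gamma> t + (s - t) *\<^sub>R v)"

lemma polygonal_at_straightI:
  assumes "\<delta> > 0" and "\<And>x. x \<in> {t - \<delta>..t + \<delta>} \<Longrightarrow> \<gamma> x = \<gamma> t + (x - t) *\<^sub>R v"
  shows "polygonal_at \<gamma> t \<delta> v v"
  unfolding polygonal_at_def
proof (intro conjI ballI assms)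
  show "x \<in> {t - \<delta>..t + \<delta>}" if "x \<in> {t - \<delta>..t}" for x using that assms(1) by auto
  show "x \<in> {t - \<delta>..t + \<delta>}" if "x \<in> {t..t + \<delta>}" for x using that assms(1) by auto
qed

lemma polygonal_at_before:
  assumes "polygonal_at \<gamma> t \<delta> w v" "t - \<delta> \<le> s" "s \<le> t"
  shows "\<gamma> s = \<gamma> t + (s - t) *\<^sub>R w"
proof -
  have "s \<in> {t - \<delta>..t}" using assms(2,3) by simp
  then show ?thesis using assms(1) unfolding polygonal_at_def by blast
qed

lemma polygonal_at_after:
  assumes "polygonal_at \<gamma> t \<delta> w v" "t \<le> s" "s \<le> t + \<delta>"
  shows "\<gamma> s = \<gamma> t + (s - t) *\<^sub>R v"
proof -
  have "s \<in> {t..t + \<delta>}" using assms(2,3) by simp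
  then show ?thesis using assms(1) unfolding polygonal_at_def by blast
qed

text \<open>At a reflection moment the outgoing velocity is chosen, which makes the velocity of a trajectory a
  function of time.\<close>

abbreviation right_velocity :: "(real \<Rightarrow> 'a::real_normed_vector) \<Rightarrow> real \<Rightarrow> 'a" where
  "right_velocity \<gamma> t \<equiv> vector_derivative \<gamma> (at t within {t..})"

lemma right_velocity_affine:
  assumes "\<delta> > 0" and aff: "\<And>s. s \<in> {t..t + \<delta>} \<Longrightarrow> \<gamma> s = \<gamma> t + (s - t) *\<^sub>R v"
  shows "right_velocity \<gamma> t = v"
proof (rule vector_derivative_within)
  have "t islimpt {t..}"
    unfolding islimpt_approachable
  proof (intro allI impI)
    fix e :: real assume "e > 0"
    then show "\<exists>x'\<in>{t..}. x' \<noteq> t \<and> dist x' t < e"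
      by (intro bexI[of _ "t + e/2"]) (auto simp: dist_real_def)
  qed
  then show "at t within {t..} \<noteq> bot" using trivial_limit_within by blast
  have "((\<lambda>s. \<gamma> t + (s - t) *\<^sub>R v) has_vector_derivative v) (at t within {t..})"
    by (auto intro!: derivative_eq_intros)
  then show "(\<gamma> has_vector_derivative v) (at t within {t..})"
  proof (rule has_vector_derivative_transform_within[OF _ \<open>\<delta> > 0\<close>])
    fix s assume "s \<in> {t..}" "dist s t < \<delta>"
    then have "s \<in> {t..t + \<delta>}" by (auto simp: dist_real_def)
    then show "\<gamma> t + (s - t) *\<^sub>R v = \<gamma> s" by (rule aff[symmetric])
  qed simp
qed

lemma polygonal_at_interior_of_segment:
  assumes aff: "\<And>x. x \<in> {a..b} \<Longrightarrow> \<gamma> x = y + (x - c) *\<^sub>R v" and s: "a < s" "s < b"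
  shows "\<exists>\<delta>. polygonal_at \<gamma> s \<delta> v v"
proof (intro exI)
  define d where "d = min (s - a) (b - s)"
  have d: "d > 0" "a \<le> s - d" "s + d \<le> b" using s by (auto simp: d_def)
  have straight: "\<gamma> x = \<gamma> s + (x - s) *\<^sub>R v" if "x \<in> {s - d..s + d}" for x
  proof -
    have x: "\<gamma> x = y + (x - c) *\<^sub>R v" and s': "\<gamma> s = y + (s - c) *\<^sub>R v"
      using that d s by (auto intro!: aff)
    show ?thesis unfolding x s' by (simp add: algebra_simps)
  qed
  show "polygonal_at \<gamma> s d v v" by (rule polygonal_at_straightI[OF d(1) straight])
qed

lemma polygonal_at_right:
  assumes P: "polygonal_at \<gamma> t \<delta> w v" and s: "t < s" "s < t + \<delta>"
  shows "\<exists>\<delta>'. polygonal_at \<gamma> s \<delta>' v v"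
proof (rule polygonal_at_interior_of_segment[OF _ s])
  show "\<gamma> x = \<gamma> t + (x - t) *\<^sub>R v" if "x \<in> {t..t + \<delta>}" for x
    using P that unfolding polygonal_at_def by blast
qed

lemma polygonal_at_left:
  assumes P: "polygonal_at \<gamma> t \<delta> w v" and s: "t - \<delta> < s" "s < t"
  shows "\<exists>\<delta>'. polygonal_at \<gamma> s \<delta>' w w"
proof (rule polygonal_at_interior_of_segment[OF _ s])
  show "\<gamma> x = \<gamma> t + (x - t) *\<^sub>R w" if "x \<in> {t - \<delta>..t}" for x
    using P that unfolding polygonal_at_def by blast
qed

lemma right_velocity_polygonal:
  assumes P: "polygonal_at \<gamma> t \<delta> w v"
  shows "right_velocity \<gamma> t = v"
proof (rule right_velocity_affine)
  show "\<delta> > 0" using P unfolding polygonal_at_def by blast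
  show "\<gamma> s = \<gamma> t + (s - t) *\<^sub>R v" if "s \<in> {t..t + \<delta>}" for s
    using that by (intro polygonal_at_after[OF P]) auto
qed

lemma right_velocity_right:
  assumes "polygonal_at \<gamma> t \<delta> w v" "t < s" "s < t + \<delta>"
  shows "right_velocity \<gamma> s = v"
  using polygonal_at_right[OF assms] by (auto dest: right_velocity_polygonal)

lemma right_velocity_left:
  assumes "polygonal_at \<gamma> t \<delta> w v" "t - \<delta> < s" "s < t"
  shows "right_velocity \<gamma> s = w"
  using polygonal_at_left[OF assms] by (auto dest: right_velocity_polygonal)

lemma reflection_moment_not_straight:
  assumes R: "t \<in> reflection_moments N \<Omega> I \<gamma>" and P: "polygonal_at \<gamma> t \<delta> v v" and v: "N v = 1"
  shows False
proof -
  obtain d where d: "d > 0" and no: "\<And>t\<^sub>1 t\<^sub>2. t\<^sub>1 \<in> {t - d<..<t} \<Longrightarrow> t\<^sub>2 \<in> {t<..<t + d} \<Longrightarrow>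
      \<not> unit_speed_segment N \<gamma> t\<^sub>1 t\<^sub>2"
    using R unfolding reflection_moments_def by blast
  have \<delta>: "\<delta> > 0" using P unfolding polygonal_at_def by blast
  have aff: "\<gamma> x = \<gamma> t + (x - t) *\<^sub>R v" if "t - \<delta> \<le> x" "x \<le> t + \<delta>" for x
    using polygonal_at_before[OF P, of x] polygonal_at_after[OF P, of x] that linear by blast
  define e where "e = min d \<delta> / 2"
  have e: "0 < e" "e < d" "e \<le> \<delta>" using d \<delta> by (auto simp: e_def)
  have "\<gamma> s = \<gamma> (t - e) + (s - (t - e)) *\<^sub>R v" if "s \<in> {t - e..t + e}" for s
  proof -
    have s: "\<gamma> s = \<gamma> t + (s - t) *\<^sub>R v" using that e by (intro aff) auto
    have t1: "\<gamma> (t - e) = \<gamma> t + ((t - e) - t) *\<^sub>R v" using e by (intro aff) auto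
    show ?thesis unfolding s t1 by (simp add: algebra_simps)
  qed
  then have "unit_speed_segment N \<gamma> (t - e) (t + e)"
    using v unfolding unit_speed_segment_def by blast
  then show False using no[of "t - e" "t + e"] e by auto
qed

section \<open>The reflection law\<close>

text \<open>The jump \<open>A\<close> of the momentum is, up to sign, the differential of the length function whose restriction
  to the boundary is critical. Strict convexity gives \<open>A (v - w) > 0\<close>, so \<open>A\<close> is positive on \<open>v\<close> or on
  \<open>- w\<close>. Both directions stay in the closed table and hence do not enter the wall that is hit;
  so \<open>A\<close> is nonpositive on \<open>q - \<gamma> t\<close> for every point \<open>q\<close> of that wall.\<close>

lemma momentum_jump_at_reflection:
  fixes N :: "'a::euclidean_space \<Rightarrow> real"
  assumes N: "minkowski_norm N" and J: "finite J" "\<And>i. i \<in> J \<Longrightarrow> wall (W i)"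
    and \<Omega>: "\<Omega> = UNIV - (\<Union>i\<in>J. W i)"
    and \<gamma>: "\<And>s. s \<in> {t..t + e} \<Longrightarrow> \<gamma> s = \<gamma> t + (s - t) *\<^sub>R v"
      "\<And>s. s \<in> {t - e..t} \<Longrightarrow> \<gamma> s = \<gamma> t + (s - t) *\<^sub>R w"
    and e: "e > 0" and unit: "N v = 1" "N w = 1" and ne: "v \<noteq> w"
    and table: "\<gamma> ` {t - e..t + e} \<subseteq> closure \<Omega>"
    and crit: "critical_point_on (\<lambda>x. N (x - \<gamma> (t - e)) + N (\<gamma> (t + e) - x)) (frontier \<Omega>) (\<gamma> t)"
    and q: "\<And>i. i \<in> J \<Longrightarrow> \<gamma> t \<in> W i \<Longrightarrow> q \<in> W i"
  shows "momentum N w (\<gamma> t - q) \<le> momentum N v (\<gamma> t - q)"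
proof -
  define A where "A = (\<lambda>h. momentum N v h - momentum N w h)"
  have v0: "v \<noteq> 0" and w0: "w \<noteq> 0" using unit_vector_nonzero N unit by blast+
  note lv = linear_momentum[OF N v0] and lw = linear_momentum[OF N w0]
  have linA: "linear A" unfolding A_def using lv lw by (rule linear_compose_sub)
  have left: "\<gamma> t - \<gamma> (t - e) = e *\<^sub>R w" and right: "\<gamma> (t + e) - \<gamma> t = e *\<^sub>R v"
    using \<gamma>(2)[of "t - e"] \<gamma>(1)[of "t + e"] e by auto
  have "(N has_derivative momentum N w) (at (\<gamma> t - \<gamma> (t - e)))"
    using has_derivative_momentum[OF N, of "e *\<^sub>R w"] momentum_scale[OF N w0 e] e w0 left by simp
  then have d1: "((\<lambda>x. N (x - \<gamma> (t - e))) has_derivative (\<lambda>h. momentum N w h)) (at (\<gamma> t))"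
    by (intro has_derivative_compose[where g = N and f = "\<lambda>x. x - \<gamma> (t - e)"])
      (auto intro!: derivative_eq_intros)
  have "(N has_derivative momentum N v) (at (\<gamma> (t + e) - \<gamma> t))"
    using has_derivative_momentum[OF N, of "e *\<^sub>R v"] momentum_scale[OF N v0 e] e v0 right by simp
  then have d2: "((\<lambda>x. N (\<gamma> (t + e) - x)) has_derivative (\<lambda>h. momentum N v (- h))) (at (\<gamma> t))"
    by (intro has_derivative_compose[where g = N and f = "\<lambda>x. \<gamma> (t + e) - x"])
      (auto intro!: derivative_eq_intros)
  have deriv: "((\<lambda>x. N (x - \<gamma> (t - e)) + N (\<gamma> (t + e) - x)) has_derivative (\<lambda>h. - A h)) (at (\<gamma> t))"
    using has_derivative_add[OF d1 d2] by (simp add: A_def linear_neg[OF lv])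
  obtain F' where F': "((\<lambda>x. N (x - \<gamma> (t - e)) + N (\<gamma> (t + e) - x)) has_derivative F') (at (\<gamma> t))"
      "\<And>h. h \<in> tangent_space (frontier \<Omega>) (\<gamma> t) \<Longrightarrow> F' h = 0"
    and smooth: "smooth_point (frontier \<Omega>) (\<gamma> t)"
    using crit unfolding critical_point_on_def by blast
  have "F' = (\<lambda>h. - A h)" using has_derivative_unique[OF F'(1) deriv] .
  then have vanish: "A h = 0" if "h \<in> tangent_space (frontier \<Omega>) (\<gamma> t)" for h
    using F'(2)[OF that] by simp
  have "closed (\<Union>i\<in>J. W i)" using J unfolding wall_def by (intro closed_UN) auto
  then have "open \<Omega>" unfolding \<Omega> by (simp add: open_Diff)
  moreover have "\<gamma> t \<in> frontier \<Omega>" using smooth unfolding smooth_point_def by blast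
  ultimately have "\<gamma> t \<notin> \<Omega>" by (simp add: frontier_def interior_open)
  then obtain i where i: "i \<in> J" "\<gamma> t \<in> W i" unfolding \<Omega> by blast
  have wall: "wall (W i)" "convex (W i)" using J(2)[OF i(1)] unfolding wall_def by auto
  have "interior (W i) \<inter> \<Omega> = {}" using i interior_subset unfolding \<Omega> by blast
  then have disj: "interior (W i) \<inter> closure \<Omega> = {}" by (simp add: open_Int_closure_eq_empty)
  have not_v: "v \<notin> entering_directions (W i) (\<gamma> t)"
  proof
    assume "v \<in> entering_directions (W i) (\<gamma> t)"
    then obtain s where s: "s > 0" "\<gamma> t + s *\<^sub>R v \<in> interior (W i)"
      unfolding entering_directions_def by blast
    define r where "r = min s e"
    have r: "0 < r" "r \<le> s" "r \<le> e" using s e by (auto simp: r_def)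
    have "\<gamma> t + r *\<^sub>R v \<in> interior (W i)"
      using interior_along_entering_direction[OF wall(2) i(2) s(2)] r by blast
    moreover have "\<gamma> t + r *\<^sub>R v = \<gamma> (t + r)" using \<gamma>(1)[of "t + r"] r by simp
    moreover have "\<gamma> (t + r) \<in> closure \<Omega>" using table r e by auto
    ultimately show False using disj by auto
  qed
  have not_w: "- w \<notin> entering_directions (W i) (\<gamma> t)"
  proof
    assume "- w \<in> entering_directions (W i) (\<gamma> t)"
    then obtain s where s: "s > 0" "\<gamma> t + s *\<^sub>R (- w) \<in> interior (W i)"
      unfolding entering_directions_def by blast
    define r where "r = min s e"
    have r: "0 < r" "r \<le> s" "r \<le> e" using s e by (auto simp: r_def)
    have "\<gamma> t + r *\<^sub>R (- w) \<in> interior (W i)"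
      using interior_along_entering_direction[OF wall(2) i(2) s(2)] r by blast
    moreover have "\<gamma> t + r *\<^sub>R (- w) = \<gamma> (t - r)" using \<gamma>(2)[of "t - r"] r by simp
    moreover have "\<gamma> (t - r) \<in> closure \<Omega>" using table r e by auto
    ultimately show False using disj by auto
  qed
  have "A v + A (- w) > 0"
    using momentum_less_1[OF N unit ne] momentum_less_1[OF N unit(2,1)] ne
      momentum_self[OF N v0] momentum_self[OF N w0] unit
    by (simp add: A_def linear_neg[OF lv] linear_neg[OF lw])
  then obtain z where "A z > 0" "z \<notin> entering_directions (W i) (\<gamma> t)"
    using not_v not_w by (metis add_nonpos_nonpos not_le)
  moreover have "frontier \<Omega> \<inter> interior (W i) = {}" using disj by (auto simp: frontier_def)
  ultimately have "A (q - \<gamma> t) \<le> 0"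
    using critical_covector_supports_wall[OF wall(1) smooth _ i(2) linA vanish] q[OF i] by blast
  moreover have "A (\<gamma> t - q) = - A (q - \<gamma> t)"
    using linear_neg[OF linA, of "q - \<gamma> t"] by simp
  ultimately show ?thesis by (simp add: A_def)
qed

lemma trajectory_polygonal:
  fixes N :: "'a::euclidean_space \<Rightarrow> real"
  assumes N: "minkowski_norm N" and J: "finite J" "\<And>i. i \<in> J \<Longrightarrow> wall (W i)"
    and \<Omega>: "\<Omega> = UNIV - (\<Union>i\<in>J. W i)"
    and traj: "billiard_trajectory N \<Omega> I \<gamma>" and t: "t \<in> interior I"
  shows "\<exists>\<delta> w v. polygonal_at \<gamma> t \<delta> w v \<and> N w = 1 \<and> N v = 1 \<and>
    (\<forall>q. (\<forall>i\<in>J. \<gamma> t \<in> W i \<longrightarrow> q \<in> W i) \<longrightarrow> momentum N w (\<gamma> t - q) \<le> momentum N v (\<gamma> t - q))"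
proof -
  obtain \<delta> where \<delta>: "\<delta> > 0" "{t - \<delta><..<t + \<delta>} \<subseteq> I"
    and alt: "\<And>t\<^sub>1 t\<^sub>2. t\<^sub>1 \<in> {t - \<delta><..<t} \<Longrightarrow> t\<^sub>2 \<in> {t<..<t + \<delta>} \<Longrightarrow>
      unit_speed_segment N \<gamma> t\<^sub>1 t\<^sub>2 \<or> reflects_at N \<Omega> \<gamma> t\<^sub>1 t t\<^sub>2"
    using traj t unfolding billiard_trajectory_def by meson
  define e where "e = \<delta> / 2"
  have e: "e > 0" "e < \<delta>" using \<delta> by (auto simp: e_def)
  have table: "\<gamma> ` {t - e..t + e} \<subseteq> closure \<Omega>"
    using traj \<delta>(2) e unfolding billiard_trajectory_def by (auto simp: image_subset_iff subset_iff)
  consider "unit_speed_segment N \<gamma> (t - e) (t + e)" | "reflects_at N \<Omega> \<gamma> (t - e) t (t + e)"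
    using alt[of "t - e" "t + e"] e by auto
  then show ?thesis
  proof cases
    case 1
    then obtain v where v: "N v = 1"
      and aff: "\<And>s. s \<in> {t - e..t + e} \<Longrightarrow> \<gamma> s = \<gamma> (t - e) + (s - (t - e)) *\<^sub>R v"
      unfolding unit_speed_segment_def by blast
    have straight: "\<gamma> s = \<gamma> t + (s - t) *\<^sub>R v" if "s \<in> {t - e..t + e}" for s
    proof -
      have "\<gamma> t = \<gamma> (t - e) + (t - (t - e)) *\<^sub>R v" using e by (intro aff) auto
      then show ?thesis unfolding aff[OF that] by (simp add: algebra_simps)
    qed
    have "polygonal_at \<gamma> t e v v" by (rule polygonal_at_straightI[OF e(1) straight])
    then show ?thesis using v by blast
  next
    case 2
    obtain w where w: "N w = 1"
      and L: "\<And>s. s \<in> {t - e..t} \<Longrightarrow> \<gamma> s = \<gamma> (t - e) + (s - (t - e)) *\<^sub>R w"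
      using 2 unfolding reflects_at_def unit_speed_segment_def by blast
    obtain v where v: "N v = 1" and Rt: "\<And>s. s \<in> {t..t + e} \<Longrightarrow> \<gamma> s = \<gamma> t + (s - t) *\<^sub>R v"
      using 2 unfolding reflects_at_def unit_speed_segment_def by blast
    have L': "\<gamma> s = \<gamma> t + (s - t) *\<^sub>R w" if "s \<in> {t - e..t}" for s
    proof -
      have "\<gamma> t = \<gamma> (t - e) + (t - (t - e)) *\<^sub>R w" using e by (intro L) auto
      then show ?thesis unfolding L[OF that] by (simp add: algebra_simps)
    qed
    have crit: "critical_point_on (\<lambda>x. N (x - \<gamma> (t - e)) + N (\<gamma> (t + e) - x)) (frontier \<Omega>) (\<gamma> t)"
      using 2 unfolding reflects_at_def by blast
    have "polygonal_at \<gamma> t e w v" using e(1) Rt L' unfolding polygonal_at_def by blast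
    moreover have "momentum N w (\<gamma> t - q) \<le> momentum N v (\<gamma> t - q)"
      if "\<forall>i\<in>J. \<gamma> t \<in> W i \<longrightarrow> q \<in> W i" for q
    proof (cases "v = w")
      case False
      show ?thesis
        using momentum_jump_at_reflection[OF N J \<Omega> Rt L' e(1) v w False table crit] that by blast
    qed simp
    ultimately show ?thesis using v w by blast
  qed
qed

section \<open>Straightness of a trajectory near an endpoint\<close>

lemma polygonal_speed_le:
  assumes N: "minkowski_norm N"
    and poly: "\<And>t. t \<in> {a<..<b} \<Longrightarrow> \<exists>\<delta> w v. polygonal_at \<gamma> t \<delta> w v \<and> N w = 1 \<and> N v = 1"
    and st: "a < s" "s \<le> t" "t < b"
  shows "N (\<gamma> t - \<gamma> s) \<le> t - s"
  using st(2)
proof (induction rule: Bolzano)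
  case (trans x y z)
  have "N (\<gamma> z - \<gamma> x) \<le> N (\<gamma> z - \<gamma> y) + N (\<gamma> y - \<gamma> x)"
    using minkowski_norm_triangle[OF N, of "\<gamma> z - \<gamma> y" "\<gamma> y - \<gamma> x"] by simp
  then show ?case using trans by linarith
next
  case (local c)
  then obtain \<delta> w v where P: "polygonal_at \<gamma> c \<delta> w v" and unit: "N w = 1" "N v = 1"
    using poly[of c] st by auto
  have \<delta>: "\<delta> > 0" using P unfolding polygonal_at_def by blast
  have "N (\<gamma> y - \<gamma> x) \<le> y - x" if xy: "x \<le> c" "c \<le> y" "y - x < \<delta>" for x y
  proof -
    have x: "\<gamma> x = \<gamma> c + (x - c) *\<^sub>R w" and y: "\<gamma> y = \<gamma> c + (y - c) *\<^sub>R v"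
      using xy by (auto intro!: polygonal_at_before[OF P] polygonal_at_after[OF P])
    have "\<gamma> y - \<gamma> x = (y - c) *\<^sub>R v + (c - x) *\<^sub>R w"
      unfolding x y by (simp add: algebra_simps)
    then have "N (\<gamma> y - \<gamma> x) \<le> N ((y - c) *\<^sub>R v) + N ((c - x) *\<^sub>R w)"
      using minkowski_norm_triangle[OF N] by metis
    also have "\<dots> = y - x" using xy unit by (simp add: minkowski_norm_scale[OF N])
    finally show ?thesis .
  qed
  then show ?case using \<delta> by blast
qed

text \<open>Along a segment with velocity \<open>v\<close> the derivative is \<open>momentum N v v = N v = 1\<close>; at a break the jump
  is nonnegative by assumption. The local estimate around each moment is globalised by bisection,
  since an induction over the breaks would presuppose that they are finitely many.\<close>

lemma momentum_growth:
  fixes N :: "'a::euclidean_space \<Rightarrow> real" and \<gamma> :: "real \<Rightarrow> 'a" and p :: 'a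
  defines "\<phi> \<equiv> \<lambda>t. momentum N (right_velocity \<gamma> t) (\<gamma> t - p)"
  assumes N: "minkowski_norm N"
    and poly: "\<And>t. t \<in> {a<..<b} \<Longrightarrow> \<exists>\<delta> w v. polygonal_at \<gamma> t \<delta> w v \<and> N w = 1 \<and> N v = 1 \<and>
      momentum N w (\<gamma> t - p) \<le> momentum N v (\<gamma> t - p)"
    and st: "a < s" "s \<le> t" "t < b"
  shows "\<phi> s + (t - s) \<le> \<phi> t"
  using st(2)
proof (induction rule: Bolzano)
  case (trans x y z)
  then show ?case by linarith
next
  case (local c)
  then obtain \<delta> w v where P: "polygonal_at \<gamma> c \<delta> w v" and unit: "N w = 1" "N v = 1"
    and jump: "momentum N w (\<gamma> c - p) \<le> momentum N v (\<gamma> c - p)"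
    using poly[of c] st by auto
  have \<delta>: "\<delta> > 0" using P unfolding polygonal_at_def by blast
  have v0: "v \<noteq> 0" and w0: "w \<noteq> 0" using unit_vector_nonzero N unit by blast+
  have \<phi>c: "\<phi> c = momentum N v (\<gamma> c - p)"
    by (simp add: \<phi>_def right_velocity_polygonal[OF P])
  have before: "\<phi> x + (c - x) \<le> \<phi> c" if x: "x \<le> c" "c - x < \<delta>" for x
  proof (cases "x = c")
    case False
    have vel: "right_velocity \<gamma> x = w" using right_velocity_left[OF P] x False by simp
    have "\<gamma> x = \<gamma> c + (x - c) *\<^sub>R w" using x by (intro polygonal_at_before[OF P]) auto
    then have diff: "\<gamma> x - p = (\<gamma> c - p) + (x - c) *\<^sub>R w" by simp
    have "\<phi> x = momentum N w (\<gamma> c - p) + (x - c) * momentum N w w"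
      unfolding \<phi>_def vel diff
      by (simp only: linear_add[OF linear_momentum[OF N w0]] linear_scale[OF linear_momentum[OF N w0]] real_scaleR_def)
    then show ?thesis using jump \<phi>c momentum_self[OF N w0] unit by simp
  qed simp
  have after: "\<phi> c + (y - c) \<le> \<phi> y" if y: "c \<le> y" "y - c < \<delta>" for y
  proof (cases "y = c")
    case False
    have vel: "right_velocity \<gamma> y = v" using right_velocity_right[OF P] y False by simp
    have "\<gamma> y = \<gamma> c + (y - c) *\<^sub>R v" using y by (intro polygonal_at_after[OF P]) auto
    then have diff: "\<gamma> y - p = (\<gamma> c - p) + (y - c) *\<^sub>R v" by simp
    have "\<phi> y = momentum N v (\<gamma> c - p) + (y - c) * momentum N v v"
      unfolding \<phi>_def vel diff
      by (simp only: linear_add[OF linear_momentum[OF N v0]] linear_scale[OF linear_momentum[OF N v0]] real_scaleR_def)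
    then show ?thesis using \<phi>c momentum_self[OF N v0] unit by simp
  qed simp
  have "\<phi> x + (y - x) \<le> \<phi> y" if "x \<le> c" "c \<le> y" "y - x < \<delta>" for x y
    using before[of x] after[of y] that by simp
  then show ?case using \<delta> by blast
qed

lemma eventually_at_endpoint:
  fixes T :: real
  assumes "open U" "T \<in> U"
  shows "\<forall>\<^sub>F s in at T within J. s \<in> U \<and> s \<in> J"
  using assms unfolding eventually_at_topological by blast

text \<open>Put \<open>\<phi> t = momentum N (right_velocity \<gamma> t) (\<gamma> t - p)\<close>. Since \<open>\<phi>\<close> grows at least at unit rate and tends
  to \<open>0\<close> at \<open>T\<close>, its absolute value is at least \<open>\<bar>t - T\<bar>\<close>. Unit speed bounds the \<open>N\<close>-length of the
  displacement between \<open>\<gamma> t\<close> and \<open>p\<close>, hence \<open>\<bar>\<phi> t\<bar>\<close>, by the same number. The equality case forces the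
  displacement to be parallel to the velocity. For the right endpoint the displacement is \<open>p - \<gamma> t\<close>, for
  the left one it is \<open>\<gamma> t - p\<close>; the order of subtraction matters as \<open>N\<close> is not symmetric.\<close>

lemma ray_through_endpoint:
  fixes N :: "'a::euclidean_space \<Rightarrow> real"
  assumes N: "minkowski_norm N"
    and poly: "\<And>t. t \<in> {a<..<b} \<Longrightarrow> \<exists>\<delta> w v. polygonal_at \<gamma> t \<delta> w v \<and> N w = 1 \<and> N v = 1 \<and>
      momentum N w (\<gamma> t - p) \<le> momentum N v (\<gamma> t - p)"
    and T: "T \<in> {a, b}" and lim: "(\<gamma> \<longlongrightarrow> p) (at T within {a<..<b})"
    and t: "a < t" "t < b"
  shows "\<gamma> t = p + (t - T) *\<^sub>R right_velocity \<gamma> t"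
proof -
  define \<phi> where "\<phi> = (\<lambda>t. momentum N (right_velocity \<gamma> t) (\<gamma> t - p))"
  let ?F = "at T within {a<..<b}"
  have "a < b" using t by simp
  have no_T: "{a<..<b} - {T} = {a<..<b}" using T by auto
  have "T \<in> closure {a<..<b}" using T \<open>a < b\<close> by auto
  then have F: "?F \<noteq> bot" unfolding at_within_eq_bot_iff no_T by blast
  have unit: "N (right_velocity \<gamma> s) = 1" if "s \<in> {a<..<b}" for s
  proof -
    obtain \<delta> w v where P: "polygonal_at \<gamma> s \<delta> w v" "N v = 1" using poly[OF \<open>s \<in> _\<close>] by blast
    then show ?thesis by (simp add: right_velocity_polygonal)
  qed
  have lin: "linear (momentum N (right_velocity \<gamma> s))" if "s \<in> {a<..<b}" for s
    using linear_momentum[OF N unit_vector_nonzero[OF N unit[OF that]]] .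
  have ineq: "momentum N (right_velocity \<gamma> s) x \<le> N x" if "s \<in> {a<..<b}" for s x
    using momentum_le[OF N unit_vector_nonzero[OF N unit[OF that]]] .
  have speed: "N (\<gamma> y - \<gamma> x) \<le> y - x" if "a < x" "x \<le> y" "y < b" for x y
    using polygonal_speed_le[OF N _ that, of \<gamma>] poly by blast
  have growth: "\<phi> x + (y - x) \<le> \<phi> y" if "a < x" "x \<le> y" "y < b" for x y
    unfolding \<phi>_def by (rule momentum_growth[OF N poly that])
  have lim0: "((\<lambda>s. N (\<gamma> s - p)) \<longlongrightarrow> 0) ?F" "((\<lambda>s. - N (p - \<gamma> s)) \<longlongrightarrow> - 0) ?F"
    using minkowski_norm_tendsto[OF N tendsto_diff[OF lim tendsto_const[of p]]]
      tendsto_minus[OF minkowski_norm_tendsto[OF N tendsto_diff[OF tendsto_const[of p] lim]]]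
    by (simp_all add: minkowski_norm_zero[OF N])
  have inJ: "\<forall>\<^sub>F s in ?F. s \<in> {a<..<b}" using eventually_at_endpoint[of UNIV T "{a<..<b}"] by simp
  have lim\<phi>: "(\<phi> \<longlongrightarrow> 0) ?F"
  proof (rule tendsto_sandwich[OF _ _ lim0(2)[simplified] lim0(1)])
    show "\<forall>\<^sub>F s in ?F. - N (p - \<gamma> s) \<le> \<phi> s"
      using inJ
    proof eventually_elim
      case (elim s)
      have "- \<phi> s = momentum N (right_velocity \<gamma> s) (p - \<gamma> s)"
        using linear_neg[OF lin[OF elim], of "\<gamma> s - p"] by (simp add: \<phi>_def)
      then show ?case using ineq[OF elim, of "p - \<gamma> s"] by simp
    qed
    show "\<forall>\<^sub>F s in ?F. \<phi> s \<le> N (\<gamma> s - p)"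
      using inJ by eventually_elim (simp add: \<phi>_def ineq)
  qed
  have tJ: "t \<in> {a<..<b}" using t by simp
  consider "T = b" | "T = a" using T by blast
  then show ?thesis
  proof cases
    case 1
    have ev: "\<forall>\<^sub>F s in ?F. t < s \<and> s < b"
      using eventually_at_endpoint[of "{t<..}" T "{a<..<b}"] 1 t by (auto elim: eventually_mono)
    have "N (p - \<gamma> t) \<le> T - t"
    proof (rule tendsto_le[OF F _ minkowski_norm_tendsto[OF N tendsto_diff[OF lim tendsto_const]]])
      show "((\<lambda>s. s - t) \<longlongrightarrow> T - t) ?F" by (intro tendsto_intros)
      show "\<forall>\<^sub>F s in ?F. N (\<gamma> s - \<gamma> t) \<le> s - t"
        using ev by eventually_elim (use t speed in auto)
    qed
    moreover have "\<phi> t + (T - t) \<le> 0"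
    proof (rule tendsto_le[OF F lim\<phi>])
      show "((\<lambda>s. \<phi> t + (s - t)) \<longlongrightarrow> \<phi> t + (T - t)) ?F" by (intro tendsto_intros)
      show "\<forall>\<^sub>F s in ?F. \<phi> t + (s - t) \<le> \<phi> s"
        using ev by eventually_elim (use t growth in auto)
    qed
    moreover have "- \<phi> t = momentum N (right_velocity \<gamma> t) (p - \<gamma> t)"
      using linear_neg[OF lin[OF tJ], of "\<gamma> t - p"] by (simp add: \<phi>_def)
    ultimately have "p - \<gamma> t = (T - t) *\<^sub>R right_velocity \<gamma> t"
      using 1 t by (intro eq_scaled_velocity_if_momentum_ge[OF N unit[OF tJ]]) auto
    then show ?thesis by (simp add: algebra_simps)
  next
    case 2
    have ev: "\<forall>\<^sub>F s in ?F. a < s \<and> s < t"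
      using eventually_at_endpoint[of "{..<t}" T "{a<..<b}"] 2 t by (auto elim: eventually_mono)
    have "N (\<gamma> t - p) \<le> t - T"
    proof (rule tendsto_le[OF F _ minkowski_norm_tendsto[OF N tendsto_diff[OF tendsto_const lim]]])
      show "((\<lambda>s. t - s) \<longlongrightarrow> t - T) ?F" by (intro tendsto_intros)
      show "\<forall>\<^sub>F s in ?F. N (\<gamma> t - \<gamma> s) \<le> t - s"
        using ev by eventually_elim (use t speed in auto)
    qed
    moreover have "0 + (t - T) \<le> \<phi> t"
    proof (rule tendsto_le[OF F tendsto_const])
      show "((\<lambda>s. \<phi> s + (t - s)) \<longlongrightarrow> 0 + (t - T)) ?F" using lim\<phi> by (intro tendsto_intros)
      show "\<forall>\<^sub>F s in ?F. \<phi> s + (t - s) \<le> \<phi> t"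
        using ev by eventually_elim (use t growth in auto)
    qed
    ultimately have "\<gamma> t - p = (t - T) *\<^sub>R right_velocity \<gamma> t"
      using 2 t by (intro eq_scaled_velocity_if_momentum_ge[OF N unit[OF tJ]]) (auto simp: \<phi>_def)
    then show ?thesis by (simp add: algebra_simps)
  qed
qed

text \<open>The velocity at any \<open>t\<close> is determined by \<open>\<gamma> t\<close> and \<open>p\<close>. The incoming velocity \<open>w\<close> is the velocity just
  before \<open>t\<close>, and the segment leading to \<open>\<gamma> t\<close> lies on the same ray, so \<open>w = v\<close>.\<close>

lemma no_reflection_on_ray:
  assumes ray: "\<And>s. a < s \<Longrightarrow> s < b \<Longrightarrow> \<gamma> s = p + (s - T) *\<^sub>R right_velocity \<gamma> s"
    and T: "T \<notin> {a<..<b}" and t: "a < t" "t < b"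
    and P: "polygonal_at \<gamma> t \<delta> w v" and v: "N v = 1"
  shows "t \<notin> reflection_moments N \<Omega> I \<gamma>"
proof -
  have \<delta>: "\<delta> > 0" using P unfolding polygonal_at_def by blast
  obtain s where s: "max a (t - \<delta>) < s" "s < t"
    using dense[of "max a (t - \<delta>)" t] t \<delta> by auto
  have "\<gamma> s = p + (s - T) *\<^sub>R w"
    using ray[of s] right_velocity_left[OF P, of s] s t by simp
  moreover have "\<gamma> s = \<gamma> t + (s - t) *\<^sub>R w"
    using s by (intro polygonal_at_before[OF P]) auto
  moreover have "\<gamma> t = p + (t - T) *\<^sub>R v"
    using ray[of t] right_velocity_polygonal[OF P] t by simp
  ultimately have "(t - T) *\<^sub>R v = (t - T) *\<^sub>R w" by (simp add: algebra_simps)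
  moreover have "t \<noteq> T" using T t by auto
  ultimately have "w = v" by simp
  then show ?thesis using reflection_moment_not_straight v P by blast
qed

text \<open>The limit is taken in the ambient space, as the endpoint need not belong to the time interval of the
  trajectory.\<close>

lemma polygonal_limit_at_endpoint:
  fixes N :: "'a::euclidean_space \<Rightarrow> real"
  assumes N: "minkowski_norm N"
    and poly: "\<And>t. t \<in> {a<..<b} \<Longrightarrow> \<exists>\<delta> w v. polygonal_at \<gamma> t \<delta> w v \<and> N w = 1 \<and> N v = 1"
    and T: "T \<in> {a, b}" "a < b"
  obtains p where "(\<gamma> \<longlongrightarrow> p) (at T within {a<..<b})"
proof -
  obtain C where C: "C \<ge> 0" "\<And>x. norm x \<le> C * N x" using norm_le_minkowski_norm[OF N] by blast
  have le: "dist (\<gamma> x) (\<gamma> y) \<le> C * dist x y" if "a < x" "x \<le> y" "y < b" for x y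
  proof -
    have "norm (\<gamma> y - \<gamma> x) \<le> C * N (\<gamma> y - \<gamma> x)" by (rule C)
    also have "\<dots> \<le> C * (y - x)"
      using C(1) polygonal_speed_le[OF N poly that] by (intro mult_left_mono) auto
    finally show ?thesis using that by (simp add: dist_norm norm_minus_commute)
  qed
  have "C-lipschitz_on {a<..<b} \<gamma>"
  proof (rule lipschitz_onI[OF _ C(1)])
    fix x y assume "x \<in> {a<..<b}" "y \<in> {a<..<b}"
    then show "dist (\<gamma> x) (\<gamma> y) \<le> C * dist x y"
      using le[of x y] le[of y x] by (cases "x \<le> y") (auto simp: dist_commute)
  qed
  then have "uniformly_continuous_on {a<..<b} \<gamma>" by (rule lipschitz_on_uniformly_continuous)
  moreover have "T \<in> closure {a<..<b}" using T by auto
  ultimately show ?thesis using that by (rule uniformly_continuous_on_extension_at_closure)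
qed

text \<open>Finitely many closed walls leave a neighbourhood \<open>V\<close> of the limit point \<open>p\<close> that only meets walls
  containing \<open>p\<close>. While \<open>\<gamma>\<close> is in \<open>V\<close>, the reflection law applies with \<open>q = p\<close>, and \<open>\<gamma>\<close> runs along a ray
  through \<open>p\<close>.\<close>

lemma no_accumulation_at_endpoint:
  fixes N :: "'a::euclidean_space \<Rightarrow> real"
  assumes N: "minkowski_norm N" and J: "finite J" "\<And>i. i \<in> J \<Longrightarrow> wall (W i)"
    and \<Omega>: "\<Omega> = UNIV - (\<Union>i\<in>J. W i)"
    and traj: "billiard_trajectory N \<Omega> I \<gamma>"
    and T: "T \<in> {a, b}" "a < b" and sub: "{a<..<b} \<subseteq> interior I"
  shows "\<exists>\<epsilon>>0. \<forall>t\<in>{a<..<b}. \<bar>t - T\<bar> < \<epsilon> \<longrightarrow> t \<notin> reflection_moments N \<Omega> I \<gamma>"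
proof -
  note local_form = trajectory_polygonal[OF N J \<Omega> traj]
  have poly: "\<exists>\<delta> w v. polygonal_at \<gamma> t \<delta> w v \<and> N w = 1 \<and> N v = 1" if "t \<in> {a<..<b}" for t
    using local_form[of t] sub that by blast
  obtain p where lim: "(\<gamma> \<longlongrightarrow> p) (at T within {a<..<b})"
    using polygonal_limit_at_endpoint[OF N poly T] by blast
  define V where "V = - (\<Union>i\<in>{i\<in>J. p \<notin> W i}. W i)"
  have "closed (\<Union>i\<in>{i\<in>J. p \<notin> W i}. W i)" using J unfolding wall_def by (intro closed_UN) auto
  then have "open V" unfolding V_def by (rule open_Compl)
  moreover have "p \<in> V" unfolding V_def by blast
  ultimately have "\<forall>\<^sub>F s in at T within {a<..<b}. \<gamma> s \<in> V" using topological_tendstoD[OF lim] by blast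
  then obtain e where e: "e > 0" "\<And>s. s \<in> {a<..<b} \<Longrightarrow> s \<noteq> T \<Longrightarrow> dist s T < e \<Longrightarrow> \<gamma> s \<in> V"
    unfolding eventually_at by blast
  define d where "d = min e (b - a)"
  have d: "d > 0" "d \<le> e" "d \<le> b - a" using e T by (auto simp: d_def)
  define a' b' where "a' = (if T = b then b - d else a)" and "b' = (if T = b then b else a + d)"
  have J': "T \<in> {a', b'}" "{a'<..<b'} \<subseteq> {a<..<b}"
    "\<And>s. s \<in> {a'<..<b'} \<longleftrightarrow> s \<in> {a<..<b} \<and> \<bar>s - T\<bar> < d"
    using T d by (auto simp: a'_def b'_def)
  have form: "\<exists>\<delta> w v. polygonal_at \<gamma> t \<delta> w v \<and> N w = 1 \<and> N v = 1 \<and>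
      momentum N w (\<gamma> t - p) \<le> momentum N v (\<gamma> t - p)" if "t \<in> {a'<..<b'}" for t
  proof -
    have "t \<in> {a<..<b}" "dist t T < e" using J'(3) that d by (auto simp: dist_real_def)
    moreover from this have "t \<noteq> T" using T by auto
    ultimately have "\<gamma> t \<in> V" by (intro e)
    then have "\<forall>i\<in>J. \<gamma> t \<in> W i \<longrightarrow> p \<in> W i" unfolding V_def by blast
    then show ?thesis using local_form[of t] sub \<open>t \<in> {a<..<b}\<close> by blast
  qed
  have ray: "\<gamma> s = p + (s - T) *\<^sub>R right_velocity \<gamma> s" if "a' < s" "s < b'" for s
    by (rule ray_through_endpoint[OF N form J'(1) tendsto_within_subset[OF lim J'(2)] that])
  have "t \<notin> reflection_moments N \<Omega> I \<gamma>" if "t \<in> {a<..<b}" "\<bar>t - T\<bar> < d" for t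
  proof -
    have t: "t \<in> {a'<..<b'}" using J'(3) that by blast
    obtain \<delta> w v where "polygonal_at \<gamma> t \<delta> w v" "N v = 1" using form[OF t] by blast
    moreover have "T \<notin> {a'<..<b'}" "a' < t" "t < b'" using J'(1) t by auto
    ultimately show ?thesis using no_reflection_on_ray[OF ray] by blast
  qed
  then show ?thesis using d by blast
qed

section \<open>Finiteness of the set of reflection moments\<close>

lemma no_accumulation_in_interior:
  assumes P: "polygonal_at \<gamma> T \<delta> w v" and unit: "N w = 1" "N v = 1"
    and t: "\<bar>t - T\<bar> < \<delta>" "t \<noteq> T"
  shows "t \<notin> reflection_moments N \<Omega> I \<gamma>"
proof (cases "T < t")
  case True
  then obtain \<delta>' where "polygonal_at \<gamma> t \<delta>' v v" using polygonal_at_right[OF P, of t] t by auto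
  then show ?thesis using reflection_moment_not_straight unit by blast
next
  case False
  then obtain \<delta>' where "polygonal_at \<gamma> t \<delta>' w w" using polygonal_at_left[OF P, of t] t by auto
  then show ?thesis using reflection_moment_not_straight unit by blast
qed

theorem theorem1:
  fixes N :: "'a::euclidean_space \<Rightarrow> real"
    and \<Omega> :: "'a set"
    and I :: "real set"
    and \<gamma> :: "real \<Rightarrow> 'a"
  assumes "semi_dispersing_minkowski_billiard N \<Omega>"
    and "billiard_trajectory N \<Omega> I \<gamma>"
    and "bounded I"
  shows "finite (reflection_moments N \<Omega> I \<gamma>)"
proof (rule ccontr)
  define R where "R = reflection_moments N \<Omega> I \<gamma>"
  assume "infinite (reflection_moments N \<Omega> I \<gamma>)"
  then have inf: "infinite R" by (simp add: R_def)
  have RI: "R \<subseteq> interior I" unfolding R_def reflection_moments_def by blast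
  have "bounded R"
    by (rule bounded_subset[OF assms(3) subset_trans[OF RI interior_subset]])
  then obtain T where T: "T islimpt R"
    by (rule bounded_infinite_imp_islimpt[OF subset_refl _ inf])
  have near: "\<exists>t\<in>R. t \<noteq> T \<and> \<bar>t - T\<bar> < e" if "e > 0" for e
    using T that unfolding islimpt_approachable by (simp add: dist_real_def)
  obtain m W where N: "minkowski_norm N" and W: "\<And>i. i \<in> {1..m::nat} \<Longrightarrow> wall (W i)"
    and \<Omega>: "\<Omega> = UNIV - (\<Union>i\<in>{1..m}. W i)"
    using assms(1) unfolding semi_dispersing_minkowski_billiard_def by blast
  have "convex (interior I)"
    using assms(2) unfolding billiard_trajectory_def by (simp add: is_interval_convex_1 convex_interior)
  then have between: "z \<in> interior I" if "x \<in> interior I" "y \<in> interior I" "x \<le> z" "z \<le> y" for x y z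
    using that unfolding is_interval_convex_1[symmetric] is_interval_1 by blast
  \<comment> \<open>Around an interior moment there is at most one break, so the reflection moments accumulate at an endpoint of \<open>I\<close>.\<close>
  have T_out: "T \<notin> interior I"
  proof
    assume "T \<in> interior I"
    then obtain \<delta> w v where P: "polygonal_at \<gamma> T \<delta> w v" "N w = 1" "N v = 1"
      using trajectory_polygonal[OF N _ W \<Omega> assms(2)] by blast
    then have "\<delta> > 0" unfolding polygonal_at_def by blast
    then obtain t where "t \<in> R" "t \<noteq> T" "\<bar>t - T\<bar> < \<delta>" using near by blast
    then show False using no_accumulation_in_interior[OF P] by (auto simp: R_def)
  qed
  obtain t0 where t0: "t0 \<in> R" using near[of 1] by auto
  then have t0I: "t0 \<in> interior I" using RI by blast
  \<comment> \<open>The interval between \<open>t0\<close> and \<open>T\<close> lies in \<open>I\<close>, on whichever side of \<open>I\<close> the endpoint \<open>T\<close> is.\<close>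
  define a b where "a = min t0 T" and "b = max t0 T"
  have "t0 \<noteq> T" using t0I T_out by auto
  then have ab: "T \<in> {a, b}" "a < b" by (auto simp: a_def b_def min_def max_def)
  have same_side: "t < T \<longleftrightarrow> t0 < T" if "t \<in> interior I" for t
  proof -
    have "t \<noteq> T" using that T_out by auto
    then show ?thesis
      using between[OF that t0I, of T] between[OF t0I that, of T] T_out \<open>t0 \<noteq> T\<close>
      by (cases "t < T"; cases "t0 < T") auto
  qed
  have sub: "{a<..<b} \<subseteq> interior I"
  proof
    fix s assume s: "s \<in> {a<..<b}"
    then have "\<bar>s - T\<bar> > 0" using ab by auto
    then obtain t where t: "t \<in> R" "t \<noteq> T" "\<bar>t - T\<bar> < \<bar>s - T\<bar>" using near by blast
    then have tI: "t \<in> interior I" using RI by blast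
    then show "s \<in> interior I"
      using between[OF t0I tI, of s] between[OF tI t0I, of s] same_side[OF tI] s t
      by (auto simp: a_def b_def min_def max_def split: if_splits)
  qed
  obtain e where e: "e > 0" "\<And>t. t \<in> {a<..<b} \<Longrightarrow> \<bar>t - T\<bar> < e \<Longrightarrow> t \<notin> R"
    using no_accumulation_at_endpoint[OF N _ W \<Omega> assms(2) ab sub] by (auto simp: R_def)
  obtain t where t: "t \<in> R" "t \<noteq> T" "\<bar>t - T\<bar> < min e (b - a)"
    using near[of "min e (b - a)"] e(1) ab(2) by auto
  have "t \<in> {a<..<b}"
    using t same_side[of t] RI by (auto simp: a_def b_def min_def max_def split: if_splits)
  then show False using e(2) t by auto
qed

end
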